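(* Let $X$ be a nonempty topological space, let $A(X)$ be a subring of $F(X)$ and let $B$ be a nonempty subset of $A(X)$ with $B\neq\{0\}$. Then there are a subset $S$ of $X$ and a ring homomorphism $\phi: A(X)\to A(S)$ such that $\ker\phi = \mathrm{Ann}(B)$, and this ideal is a fixed ideal of $A(X)$.
   Context: For a nonempty topological space $Y$, $F(Y)$ is the ring of all functions $Y\to\mathbb{R}$ with pointwise operations. Here $A$ is understood as a rule (given by some special property of functions, e.g. continuity, being Baire one, or having finitely many discontinuities) that assigns to each nonempty topological space $Y$ a subring $A(Y)$ of $F(Y)$; a subset $S\subseteq X$ carries the subspace topology, and restrictions to $S$ of members of $A(X)$ belong to $A(S)$. For $f\in F(X)$, $Z(f)=\{x\in X: f(x)=0\}$. $\mathrm{Ann}(B)=\{f\in A(X): fb=0 \text{ for all } b\in B\}$. An ideal $I$ of $A(X)$ is fixed if $\bigcap_{f\in I} Z(f)\neq\emptyset$. *)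

theory Defs
  imports "HOL-Algebra.Subrings" "HOL-Algebra.RingHom" "HOL-Analysis.Abstract_Topology"
begin

text \<open>
  A real-valued function on a space is encoded as a total function that is \<open>undefined\<close> off
  \<open>topspace Y\<close>, so that equality in the carrier is equality of functions on the space.
\<close>

definition function_ring :: "'a topology \<Rightarrow> ('a \<Rightarrow> real) ring" where
  "function_ring Y =
    \<lparr>carrier = extensional (topspace Y),
     monoid.mult = (\<lambda>f g. \<lambda>x\<in>topspace Y. f x * g x),
     one = (\<lambda>x\<in>topspace Y. 1),
     zero = (\<lambda>x\<in>topspace Y. 0),
     add = (\<lambda>f g. \<lambda>x\<in>topspace Y. f x + g x)\<rparr>"

text \<open>
  A rule assigning rings of functions is a function on the topologies carried by subsets of one
  type. All subspaces of a space live over the type of that space, so this is all that is needed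
  of the rule. Subrings contain the constant function 1 and ring homomorphisms preserve it, as
  everywhere in HOL-Algebra.
\<close>

definition function_ring_rule :: "('a topology \<Rightarrow> ('a \<Rightarrow> real) set) \<Rightarrow> bool" where
  "function_ring_rule A \<longleftrightarrow>
     (\<forall>Y. topspace Y \<noteq> {} \<longrightarrow> subring (A Y) (function_ring Y)) \<and>
     (\<forall>Y S f. S \<subseteq> topspace Y \<and> S \<noteq> {} \<and> f \<in> A Y \<longrightarrow> restrict f S \<in> A (subtopology Y S))"

definition ring_of_rule ::
    "('a topology \<Rightarrow> ('a \<Rightarrow> real) set) \<Rightarrow> 'a topology \<Rightarrow> ('a \<Rightarrow> real) ring" where
  "ring_of_rule A Y = (function_ring Y)\<lparr>carrier := A Y\<rparr>"

definition zero_set :: "'a topology \<Rightarrow> ('a \<Rightarrow> real) \<Rightarrow> 'a set" where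
  "zero_set X f = {x \<in> topspace X. f x = 0}"

definition annihilator :: "('r, 'm) ring_scheme \<Rightarrow> 'r set \<Rightarrow> 'r set" where
  "annihilator R B = {f \<in> carrier R. \<forall>b\<in>B. f \<otimes>\<^bsub>R\<^esub> b = \<zero>\<^bsub>R\<^esub>}"

definition fixed_ideal ::
    "('a topology \<Rightarrow> ('a \<Rightarrow> real) set) \<Rightarrow> 'a topology \<Rightarrow> ('a \<Rightarrow> real) set \<Rightarrow> bool" where
  "fixed_ideal A X I \<longleftrightarrow>
     ideal I (ring_of_rule A X) \<and> (\<Inter>f\<in>I. zero_set X f) \<noteq> {}"

end

theory Submission
  imports Defs
begin

text \<open>
  Take \<open>S\<close> to be the union of the cozero sets of the members of \<open>B\<close>. As the reals have no zero
  divisors, \<open>f\<close> annihilates \<open>B\<close> iff \<open>f\<close> vanishes on \<open>S\<close>, i.e. iff \<open>f\<close> lies in the kernel of the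
  restriction map to \<open>S\<close>; and every point of \<open>S\<close> witnesses that this kernel is fixed.
\<close>

text \<open>The laws are inherited pointwise from the reals. Extensionality enters in the unit laws:
  adding zero or multiplying by one returns \<open>f\<close> itself because \<open>f\<close> is
  already \<open>undefined\<close> off the space.\<close>

lemma ring_function_ring: "ring (function_ring Y)"
proof (rule ringI)
  show "abelian_group (function_ring Y)"
  proof (rule abelian_groupI)
    fix f assume "f \<in> carrier (function_ring Y)"
    then show "\<exists>g\<in>carrier (function_ring Y). g \<oplus>\<^bsub>function_ring Y\<^esub> f = \<zero>\<^bsub>function_ring Y\<^esub>"
      by (intro bexI[of _ "\<lambda>x\<in>topspace Y. - f x"]) (auto simp: function_ring_def)
  qed (auto simp: function_ring_def fun_eq_iff extensional_def)
  show "monoid (function_ring Y)"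
    by (rule monoidI) (auto simp: function_ring_def fun_eq_iff extensional_def)
qed (auto simp: function_ring_def fun_eq_iff algebra_simps)

lemma ring_ring_of_rule:
  assumes "function_ring_rule A" "topspace Y \<noteq> {}"
  shows "ring (ring_of_rule A Y)"
  using assms ring.subring_is_ring[OF ring_function_ring]
  unfolding function_ring_rule_def ring_of_rule_def by blast

lemma rule_subset_extensional:
  assumes "function_ring_rule A" "topspace Y \<noteq> {}"
  shows "A Y \<subseteq> extensional (topspace Y)"
  using assms subringE(1)[of "A Y" "function_ring Y"]
  unfolding function_ring_rule_def by (auto simp: function_ring_def)

lemma ring_of_rule_simps [simp]:
  "carrier (ring_of_rule A Y) = A Y"
  "\<zero>\<^bsub>ring_of_rule A Y\<^esub> = (\<lambda>x\<in>topspace Y. 0)"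
  "\<one>\<^bsub>ring_of_rule A Y\<^esub> = (\<lambda>x\<in>topspace Y. 1)"
  "f \<oplus>\<^bsub>ring_of_rule A Y\<^esub> g = (\<lambda>x\<in>topspace Y. f x + g x)"
  "f \<otimes>\<^bsub>ring_of_rule A Y\<^esub> g = (\<lambda>x\<in>topspace Y. f x * g x)"
  by (simp_all add: ring_of_rule_def function_ring_def)

text \<open>Closure of the rule under restriction puts the image in the target; it is available for
  nonempty \<open>S\<close>.\<close>

lemma restrict_ring_hom:
  assumes "function_ring_rule A" "S \<subseteq> topspace X" "S \<noteq> {}"
  shows "(\<lambda>f. restrict f S) \<in> ring_hom (ring_of_rule A X) (ring_of_rule A (subtopology X S))"
  using assms by (intro ring_hom_memI) (auto simp: function_ring_rule_def fun_eq_iff)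

lemma a_kernel_restrict:
  assumes "S \<subseteq> topspace X"
  shows "a_kernel (ring_of_rule A X) (ring_of_rule A (subtopology X S)) (\<lambda>f. restrict f S)
           = {f \<in> A X. \<forall>x\<in>S. f x = 0}"
  using assms by (auto simp: a_kernel_def' fun_eq_iff)

text \<open>A product \<open>f x * b x\<close> of reals vanishes iff a factor does, so
  \<open>f\<close> must vanish wherever some \<open>b\<close> in \<open>B\<close> does not; those
  points are the complement of the common zero set.\<close>

lemma annihilator_ring_of_rule:
  "annihilator (ring_of_rule A X) B
     = {f \<in> A X. \<forall>x \<in> topspace X - (\<Inter>b\<in>B. zero_set X b). f x = 0}"
  by (auto simp: annihilator_def zero_set_def fun_eq_iff)

theorem theorem2p3:
  fixes X :: "'a topology"
    and A :: "'a topology \<Rightarrow> ('a \<Rightarrow> real) set"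
    and B :: "('a \<Rightarrow> real) set"
  assumes "function_ring_rule A"
    and "topspace X \<noteq> {}"
    and "B \<subseteq> A X"
    and "B \<noteq> {}"
    and "B \<noteq> {\<zero>\<^bsub>ring_of_rule A X\<^esub>}"
  shows "\<exists>S \<phi>. S \<subseteq> topspace X \<and> S \<noteq> {} \<and>
           \<phi> \<in> ring_hom (ring_of_rule A X) (ring_of_rule A (subtopology X S)) \<and>
           a_kernel (ring_of_rule A X) (ring_of_rule A (subtopology X S)) \<phi>
             = annihilator (ring_of_rule A X) B \<and>
           fixed_ideal A X (annihilator (ring_of_rule A X) B)"
proof -
  define S where "S = topspace X - (\<Inter>b\<in>B. zero_set X b)"
  let ?R = "ring_of_rule A X" and ?R' = "ring_of_rule A (subtopology X S)"
  let ?\<phi> = "\<lambda>f::'a \<Rightarrow> real. restrict f S"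
  have S: "S \<subseteq> topspace X"
    by (simp add: S_def)
  obtain b where b: "b \<in> B" "b \<noteq> \<zero>\<^bsub>?R\<^esub>"
    using assms(4,5) by blast
  moreover have "b \<in> extensional (topspace X)"
    using b(1) assms(3) rule_subset_extensional[OF assms(1,2)] by blast
  \<comment> \<open>Off the space \<open>b\<close> and the zero function are both
    \<open>undefined\<close>, so they differ at a point of the space.\<close>
  ultimately obtain x where "x \<in> topspace X" "b x \<noteq> 0"
    by (auto simp: fun_eq_iff extensional_def split: if_splits)
  with b(1) have x: "x \<in> S"
    by (auto simp: S_def zero_set_def)
  then have ne: "S \<noteq> {}" by blast
  have hom: "?\<phi> \<in> ring_hom ?R ?R'"
    by (rule restrict_ring_hom[OF assms(1) S ne])
  have ann: "annihilator ?R B = {f \<in> A X. \<forall>x\<in>S. f x = 0}"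
    by (simp add: annihilator_ring_of_rule S_def)
  then have ker: "a_kernel ?R ?R' ?\<phi> = annihilator ?R B"
    by (simp add: a_kernel_restrict[OF S])
  \<comment> \<open>The rule yields a ring over nonempty spaces, so this makes the target a ring and
    lets the kernel be recognised as an ideal.\<close>
  have "topspace (subtopology X S) \<noteq> {}"
    using S ne by auto
  then interpret ring_hom_ring ?R ?R' ?\<phi>
    by (intro ring_hom_ringI2 ring_ring_of_rule assms(1,2) hom)
  have "ideal (annihilator ?R B) ?R"
    using kernel_is_ideal ker by simp
  moreover have "x \<in> (\<Inter>f\<in>annihilator ?R B. zero_set X f)"
    using x S by (auto simp: ann zero_set_def)
  ultimately have "fixed_ideal A X (annihilator ?R B)"
    unfolding fixed_ideal_def by blast
  with S ne hom ker show ?thesis by blast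
qed

end
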